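(* Let there be given a variant of Buchberger's Algorithm (working in $\overline F$ with respect to $\overline\sigma$), and let $U,V\in\overline F$ be homogeneous non-zero vectors which are used during the execution of the algorithm. (1) We have $(U^{\rm sw})^{\rm sat}=U^{\rm sat}$, and $\mathrm{sugar}(U)$ is componentwise greater than or equal to $\deg_{\overline W}(U)$. (2) Suppose that $U$ is reducible by $V$: let $\mathrm{LT}_{\overline\sigma}(U)=t'\,\mathrm{LT}_{\overline\sigma}(V)$ with $t'=y_1^{a_1}\cdots y_m^{a_m}\,t$, $t\in\mathbb{T}^n$, let $\mathrm{LC}_{\overline\sigma}(U)=c\,\mathrm{LC}_{\overline\sigma}(V)$, and let $A=U-c\,t'\,V$ be the result of the reduction. Then $$\mathrm{sugar}(A)=\mathrm{Top}\big(\mathrm{sugar}(U),\ \deg_{\overline W}(t)+\mathrm{sugar}(V)\big).$$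
   Context: Setting. $K$ is a field, $P=K[x_1,\dots,x_n]$, $W\in\mathrm{Mat}_{m,n}(\mathbb{Z})$ is a matrix of rank $m\ge 1$, and $\overline{P}=K[y_1,\dots,y_m,x_1,\dots,x_n]$ is graded by $\overline{W}=(I_m\mid W)$, i.e. $\deg_{\overline W}(y_i)$ is the $i$-th standard basis vector of $\mathbb{Z}^m$ and $\deg_{\overline W}(x_j)$ is the $j$-th column of $W$. $\mathbb{T}^n$ is the monoid of power products in the $x_j$. $F=P^r$ has canonical basis $e_1,\dots,e_r$; $\delta_1,\dots,\delta_r\in\mathbb{Z}^m$ are fixed and $\overline{F}=\bigoplus_{i=1}^r\overline{P}(-\delta_i)$, so $\deg(te_i)=\deg(t)+\delta_i$. $\mathbb{Z}^m$ is ordered lexicographically. $\mathrm{Top}(v_1,\dots,v_s)$ is the componentwise maximum of $v_1,\dots,v_s\in\mathbb{Z}^m$. Orderings. $\sigma$ is a module ordering on the terms $te_i$ of $F$: a total ordering compatible with multiplication by power products and with a monoid ordering on $\mathbb{T}^n$. Its extension $\overline\sigma$ by $W$ to the terms of $\overline F$: $t_1e_i>_{\overline\sigma}t_2e_j$ iff $\deg_{\overline W}(t_1e_i)>\deg_{\overline W}(t_2e_j)$, or these degrees are equal and $t_1^{\rm deh}e_i>_\sigma t_2^{\rm deh}e_j$. LT, LC denote leading term and leading coefficient. Homogenization. For $V\in\overline F$, $V^{\rm deh}\in F$ is obtained by setting all $y_i=1$. For $0\ne v=\sum_j c_jt_je_{i_j}\in F$ (distinct terms, $c_j\ne0$), with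 $\mu=\mathrm{Top}$ of the $\deg_W(t_je_{i_j})$, $v^{\rm hom}=\sum_j c_j\,y^{\mu-\deg_W(t_je_{i_j})}t_je_{i_j}$; $0^{\rm hom}=0$. For homogeneous $U\in\overline F$, $U^{\rm sat}=(U^{\rm deh})^{\rm hom}$. Variants of Buchberger's Algorithm. If $U,V$ have leading monomials $c_Ut_Ue_i$, $c_Vt_Ve_i$, then $S(U,V)=\frac{\mathrm{lcm}(t_U,t_V)}{c_Ut_U}U-\frac{\mathrm{lcm}(t_U,t_V)}{c_Vt_V}V$; for homogeneous $U,V$ its degree is the degree of $\mathrm{lcm}(t_U,t_V)e_i$ (this is the convention if $S(U,V)=0$). A variant of Buchberger's Algorithm starts from homogeneous input vectors $U_1,\dots,U_s\in\overline F$ with Pairs $=\emptyset$, Gens $=(U_1,\dots,U_s)$, $\mathcal G=\emptyset$ and, while Gens $\ne\emptyset$ or Pairs $\ne\emptyset$: chooses and removes either $Q\in$ Gens, or a pair $(V_i,V_j)\in$ Pairs, in which case $Q=S(V_i,V_j)$; computes from $Q$ a vector $V$ by division by $\mathcal G$, where at each step the current vector may also be replaced by a homogeneous vector with the same saturation, until the vector is zero or its leading term is not divisible by the leading term of any element of $\mathcal G$; if $V\neq0$, adds $V$ to $\mathcal G$ and the pairs of $V$ with the previous elements of $\mathcal G$ to Pairs. A reduction step $U\mapsto U-c\,t'\,V$ cancelling the leading term of $U$ is regarded as the formation of the S-vector $S(U,V)$ (it equals it up to a non-zero scalar). Sweetened vectors and sugar. A companion vector of a homogeneous $V$ is a vector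 $y_1^{s_1}\cdots y_m^{s_m}V$ with $s_i\ge0$. To each vector $V$ used during the execution a companion vector $V^{\rm sw}$ is attached by the rules: (i) $U_i^{\rm sw}=U_i$ for the input vectors; (ii) $S(U,V)^{\rm sw}=S(U^{\rm sw},V^{\rm sw})$ (up to the corresponding scalar in the case of reduction steps); (iii) when $V$ is replaced by $V'$ with $(V')^{\rm sat}=V^{\rm sat}$, and $V^{\rm sw}=y_1^{a_1}\cdots y_m^{a_m}V^{\rm sat}$, $V'=y_1^{b_1}\cdots y_m^{b_m}V^{\rm sat}$, then $(V')^{\rm sw}=y_1^{c_1}\cdots y_m^{c_m}V^{\rm sat}$ with $(c_1,\dots,c_m)=\mathrm{Top}((a_1,\dots,a_m),(b_1,\dots,b_m))$. Finally $\mathrm{sugar}(V)=\deg_{\overline W}(V^{\rm sw})$. *)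

theory Defs
  imports
    "HOL-Analysis.Analysis"
    "HOL-Library.Poly_Mapping"
    "HOL-Library.Fun_Lexorder"
    "HOL-Library.Multiset"
begin

text \<open>
  The index types \<open>'m\<close>, \<open>'n\<close>, \<open>'r\<close> stand for \<open>{1..m}\<close>, \<open>{1..n}\<close>, \<open>{1..r}\<close>. A power product
  is its exponent vector, so multiplication of power products is \<open>+\<close>; the pair \<open>(s, t)\<close> is
  \<open>y\<^sup>s x\<^sup>t\<close>. A term \<open>t e\<^sub>i\<close> of a free module is the pair \<open>(t, i)\<close>.
\<close>

type_synonym 'n xpp = "nat ^ 'n"
type_synonym ('m, 'n) ypp = "(nat ^ 'm) \<times> (nat ^ 'n)"

type_synonym 'm zvec = "int ^ 'm"
type_synonym ('m, 'n) zmat = "int ^ 'n ^ 'm"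
type_synonym ('m, 'r) shifts = "'r \<Rightarrow> int ^ 'm"

type_synonym ('k, 'n, 'r) F_vec = "(('n xpp) \<Rightarrow>\<^sub>0 'k) ^ 'r"
type_synonym ('k, 'm, 'n, 'r) Fbar_vec = "((('m, 'n) ypp) \<Rightarrow>\<^sub>0 'k) ^ 'r"

definition terms :: "(('t \<Rightarrow>\<^sub>0 'k::zero) ^ 'r) \<Rightarrow> ('t \<times> 'r) set" where
  "terms v = {(t, i). t \<in> Poly_Mapping.keys (v $ i)}"

definition coeff_at :: "(('t \<Rightarrow>\<^sub>0 'k::zero) ^ 'r) \<Rightarrow> 't \<times> 'r \<Rightarrow> 'k" where
  "coeff_at v a = Poly_Mapping.lookup (v $ snd a) (fst a)"

definition Top :: "('a::linorder ^ 'm) set \<Rightarrow> 'a ^ 'm" where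
  "Top S = (\<chi> k. Max ((\<lambda>v. v $ k) ` S))"


subsection \<open>The grading\<close>

text \<open>The first summand comes from the block \<open>I\<^sub>m\<close> of the grading matrix \<open>(I\<^sub>m | W)\<close>.\<close>

definition pp_deg :: "('m, 'n) zmat \<Rightarrow> ('m::finite, 'n::finite) ypp \<Rightarrow> 'm zvec" where
  "pp_deg W p = (\<chi> k. int (fst p $ k)) + W *v (\<chi> j. int (snd p $ j))"

definition term_deg ::
  "('m, 'n) zmat \<Rightarrow> ('m, 'r) shifts \<Rightarrow> ('m::finite, 'n::finite) ypp \<times> 'r \<Rightarrow> 'm zvec" where
  "term_deg W \<delta> a = pp_deg W (fst a) + \<delta> (snd a)"

definition F_term_deg ::
  "('m, 'n) zmat \<Rightarrow> ('m, 'r) shifts \<Rightarrow> ('n::finite) xpp \<times> 'r \<Rightarrow> ('m::finite) zvec" where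
  "F_term_deg W \<delta> a = term_deg W \<delta> ((0, fst a), snd a)"

definition homogeneous ::
  "('m, 'n) zmat \<Rightarrow> ('m, 'r) shifts \<Rightarrow>
   ('k::zero, 'm::finite, 'n::finite, 'r::finite) Fbar_vec \<Rightarrow> bool" where
  "homogeneous W \<delta> V \<longleftrightarrow> (\<exists>d. \<forall>a\<in>terms V. term_deg W \<delta> a = d)"

text \<open>Only meaningful for non-zero homogeneous vectors.\<close>

definition deg ::
  "('m, 'n) zmat \<Rightarrow> ('m, 'r) shifts \<Rightarrow>
   ('k::zero, 'm::finite, 'n::finite, 'r::finite) Fbar_vec \<Rightarrow> 'm zvec" where
  "deg W \<delta> V = (THE d. \<forall>a\<in>terms V. term_deg W \<delta> a = d)"


subsection \<open>Orderings\<close>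

text \<open>A pair \<open>(a, b)\<close> in an ordering means \<open>a \<le> b\<close>. Well-foundedness is not required.\<close>

definition monoid_ordering :: "('n::finite) xpp rel \<Rightarrow> bool" where
  "monoid_ordering \<tau> \<longleftrightarrow> linear_order \<tau> \<and> (\<forall>s t u. (s, t) \<in> \<tau> \<longrightarrow> (u + s, u + t) \<in> \<tau>)"

definition module_ordering :: "(('n::finite) xpp \<times> 'r) rel \<Rightarrow> bool" where
  "module_ordering \<sigma> \<longleftrightarrow>
     linear_order \<sigma> \<and>
     (\<forall>s i t j u. ((s, i), (t, j)) \<in> \<sigma> \<longrightarrow> ((u + s, i), (u + t, j)) \<in> \<sigma>) \<and>
     (\<exists>\<tau>. monoid_ordering \<tau> \<and> (\<forall>s t i. (s, t) \<in> \<tau> \<longrightarrow> ((s, i), (t, i)) \<in> \<sigma>))"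

definition lex_less :: "('m::{finite,linorder}) zvec \<Rightarrow> 'm zvec \<Rightarrow> bool" where
  "lex_less d e \<longleftrightarrow> less_fun (\<lambda>k. d $ k) (\<lambda>k. e $ k)"

text \<open>The strict version of the extension of \<open>\<sigma>\<close> by \<open>W\<close>; dehomogenizing \<open>y\<^sup>s x\<^sup>t e\<^sub>i\<close> gives
  \<open>x\<^sup>t e\<^sub>i\<close>.\<close>

definition ext_less ::
  "('m, 'n) zmat \<Rightarrow> ('m, 'r) shifts \<Rightarrow> (('n::finite) xpp \<times> 'r) rel \<Rightarrow>
   ('m::{finite,linorder}, 'n) ypp \<times> 'r \<Rightarrow> ('m, 'n) ypp \<times> 'r \<Rightarrow> bool" where
  "ext_less W \<delta> \<sigma> a b \<longleftrightarrow>
     lex_less (term_deg W \<delta> a) (term_deg W \<delta> b) \<or>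
     term_deg W \<delta> a = term_deg W \<delta> b \<and>
     (let a' = (snd (fst a), snd a); b' = (snd (fst b), snd b) in (a', b') \<in> \<sigma> \<and> a' \<noteq> b')"

definition LT ::
  "('m, 'n) zmat \<Rightarrow> ('m, 'r) shifts \<Rightarrow> (('n::finite) xpp \<times> 'r) rel \<Rightarrow>
   ('k::zero, 'm::{finite,linorder}, 'n, 'r::finite) Fbar_vec \<Rightarrow> ('m, 'n) ypp \<times> 'r" where
  "LT W \<delta> \<sigma> V = (THE a. a \<in> terms V \<and> (\<forall>b\<in>terms V. b \<noteq> a \<longrightarrow> ext_less W \<delta> \<sigma> b a))"

definition LC ::
  "('m, 'n) zmat \<Rightarrow> ('m, 'r) shifts \<Rightarrow> (('n::finite) xpp \<times> 'r) rel \<Rightarrow>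
   ('k::zero, 'm::{finite,linorder}, 'n, 'r::finite) Fbar_vec \<Rightarrow> 'k" where
  "LC W \<delta> \<sigma> V = coeff_at V (LT W \<delta> \<sigma> V)"


subsection \<open>Homogenization\<close>

definition deh ::
  "('k::comm_monoid_add, 'm::finite, 'n::finite, 'r::finite) Fbar_vec \<Rightarrow> ('k, 'n, 'r) F_vec" where
  "deh V = (\<chi> i. \<Sum>p\<in>Poly_Mapping.keys (V $ i). Poly_Mapping.single (snd p) (Poly_Mapping.lookup (V $ i) p))"

definition hom ::
  "('m, 'n) zmat \<Rightarrow> ('m, 'r) shifts \<Rightarrow>
   ('k::comm_monoid_add, 'n::finite, 'r::finite) F_vec \<Rightarrow> ('k, 'm::finite, 'n, 'r) Fbar_vec" where
  "hom W \<delta> v =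
     (let \<mu> = Top (F_term_deg W \<delta> ` terms v)
      in \<chi> i. \<Sum>t\<in>Poly_Mapping.keys (v $ i).
           Poly_Mapping.single (\<chi> k. nat ((\<mu> - F_term_deg W \<delta> (t, i)) $ k), t) (Poly_Mapping.lookup (v $ i) t))"

definition sat ::
  "('m, 'n) zmat \<Rightarrow> ('m, 'r) shifts \<Rightarrow>
   ('k::comm_monoid_add, 'm::finite, 'n::finite, 'r::finite) Fbar_vec \<Rightarrow>
   ('k, 'm, 'n, 'r) Fbar_vec" where
  "sat W \<delta> U = hom W \<delta> (deh U)"

definition monomial ::
  "'k \<Rightarrow> ('m::finite, 'n::finite) ypp \<Rightarrow> (('m, 'n) ypp \<Rightarrow>\<^sub>0 'k::zero)" where
  "monomial c p = Poly_Mapping.single p c"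

definition y_mult ::
  "nat ^ ('m::finite) \<Rightarrow> ('k::semiring_1, 'm::finite, 'n::finite, 'r::finite) Fbar_vec \<Rightarrow>
   ('k, 'm, 'n, 'r) Fbar_vec" where
  "y_mult a V = monomial 1 (a, 0) *s V"


subsection \<open>S-vectors and reduction\<close>

definition pp_lcm :: "('m::finite, 'n::finite) ypp \<Rightarrow> ('m, 'n) ypp \<Rightarrow> ('m, 'n) ypp" where
  "pp_lcm p q = (Top {fst p, fst q}, Top {snd p, snd q})"

text \<open>The next two definitions are for non-zero \<open>U\<close>, \<open>V\<close> whose leading terms lie in the same
  component. Subtraction of exponents is exact in \<open>S_vec\<close>.\<close>

definition S_vec ::
  "('m, 'n) zmat \<Rightarrow> ('m, 'r) shifts \<Rightarrow> (('n::finite) xpp \<times> 'r) rel \<Rightarrow>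
   ('k::field, 'm::{finite,linorder}, 'n, 'r::finite) Fbar_vec \<Rightarrow> ('k, 'm, 'n, 'r) Fbar_vec \<Rightarrow>
   ('k, 'm, 'n, 'r) Fbar_vec" where
  "S_vec W \<delta> \<sigma> U V =
     (let p = fst (LT W \<delta> \<sigma> U); q = fst (LT W \<delta> \<sigma> V); l = pp_lcm p q
      in monomial (1 / LC W \<delta> \<sigma> U) (l - p) *s U - monomial (1 / LC W \<delta> \<sigma> V) (l - q) *s V)"

definition S_lcm_deg ::
  "('m, 'n) zmat \<Rightarrow> ('m, 'r) shifts \<Rightarrow> (('n::finite) xpp \<times> 'r) rel \<Rightarrow>
   ('k::field, 'm::{finite,linorder}, 'n, 'r::finite) Fbar_vec \<Rightarrow> ('k, 'm, 'n, 'r) Fbar_vec \<Rightarrow>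
   'm zvec" where
  "S_lcm_deg W \<delta> \<sigma> U V =
     term_deg W \<delta> (pp_lcm (fst (LT W \<delta> \<sigma> U)) (fst (LT W \<delta> \<sigma> V)), snd (LT W \<delta> \<sigma> U))"

definition same_component ::
  "('m, 'n) zmat \<Rightarrow> ('m, 'r) shifts \<Rightarrow> (('n::finite) xpp \<times> 'r) rel \<Rightarrow>
   ('k::field, 'm::{finite,linorder}, 'n, 'r::finite) Fbar_vec \<Rightarrow> ('k, 'm, 'n, 'r) Fbar_vec \<Rightarrow>
   bool" where
  "same_component W \<delta> \<sigma> U V \<longleftrightarrow> snd (LT W \<delta> \<sigma> U) = snd (LT W \<delta> \<sigma> V)"

definition reducible_by ::
  "('m, 'n) zmat \<Rightarrow> ('m, 'r) shifts \<Rightarrow> (('n::finite) xpp \<times> 'r) rel \<Rightarrow>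
   ('k::field, 'm::{finite,linorder}, 'n, 'r::finite) Fbar_vec \<Rightarrow> ('k, 'm, 'n, 'r) Fbar_vec \<Rightarrow>
   bool" where
  "reducible_by W \<delta> \<sigma> U V \<longleftrightarrow>
     same_component W \<delta> \<sigma> U V \<and> (\<exists>p. fst (LT W \<delta> \<sigma> U) = p + fst (LT W \<delta> \<sigma> V))"

definition reduct ::
  "('m, 'n) zmat \<Rightarrow> ('m, 'r) shifts \<Rightarrow> (('n::finite) xpp \<times> 'r) rel \<Rightarrow>
   ('k::field, 'm::{finite,linorder}, 'n, 'r::finite) Fbar_vec \<Rightarrow> ('k, 'm, 'n, 'r) Fbar_vec \<Rightarrow>
   ('k, 'm, 'n, 'r) Fbar_vec" where
  "reduct W \<delta> \<sigma> U V =
     U - monomial (LC W \<delta> \<sigma> U / LC W \<delta> \<sigma> V) (fst (LT W \<delta> \<sigma> U) - fst (LT W \<delta> \<sigma> V)) *s V"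


subsection \<open>Vectors with their history, sweetened vectors and sugar\<close>

text \<open>
  The same vector can arise several times with different companions, so companion vectors are
  attached to occurrences of vectors. An occurrence is identified with the way it was obtained:
  an input vector, an S-vector of two occurrences, the result of reducing the first occurrence by
  the second, or a replacement of an occurrence by a vector with the same saturation.
\<close>

datatype 'v occurrence =
    Input 'v
  | SVector "'v occurrence" "'v occurrence"
  | Reduct "'v occurrence" "'v occurrence"
  | Replaced "'v occurrence" 'v

primrec vector_of ::
  "('m, 'n) zmat \<Rightarrow> ('m, 'r) shifts \<Rightarrow> (('n::finite) xpp \<times> 'r) rel \<Rightarrow>
   ('k::field, 'm::{finite,linorder}, 'n, 'r::finite) Fbar_vec occurrence \<Rightarrow>
   ('k, 'm, 'n, 'r) Fbar_vec" where
  "vector_of W \<delta> \<sigma> (Input U) = U"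
| "vector_of W \<delta> \<sigma> (SVector X Y) = S_vec W \<delta> \<sigma> (vector_of W \<delta> \<sigma> X) (vector_of W \<delta> \<sigma> Y)"
| "vector_of W \<delta> \<sigma> (Reduct X Y) = reduct W \<delta> \<sigma> (vector_of W \<delta> \<sigma> X) (vector_of W \<delta> \<sigma> Y)"
| "vector_of W \<delta> \<sigma> (Replaced X V') = V'"

text \<open>The exponent \<open>a\<close> with \<open>U = y\<^sup>a V\<close>; it is unique if \<open>V \<noteq> 0\<close>.\<close>

definition y_exponent ::
  "('k::semiring_1, 'm::finite, 'n::finite, 'r::finite) Fbar_vec \<Rightarrow> ('k, 'm, 'n, 'r) Fbar_vec \<Rightarrow>
   nat ^ ('m::finite)" where
  "y_exponent U V = (THE a. U = y_mult a V)"

text \<open>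
  In the third equation, \<open>reduct U V = LC U \<cdot> S(U, V)\<close> determines the scalar.
\<close>

primrec sweet ::
  "('m, 'n) zmat \<Rightarrow> ('m, 'r) shifts \<Rightarrow> (('n::finite) xpp \<times> 'r) rel \<Rightarrow>
   ('k::field, 'm::{finite,linorder}, 'n, 'r::finite) Fbar_vec occurrence \<Rightarrow>
   ('k, 'm, 'n, 'r) Fbar_vec" where
  "sweet W \<delta> \<sigma> (Input U) = U"
| "sweet W \<delta> \<sigma> (SVector X Y) = S_vec W \<delta> \<sigma> (sweet W \<delta> \<sigma> X) (sweet W \<delta> \<sigma> Y)"
| "sweet W \<delta> \<sigma> (Reduct X Y) =
     monomial (LC W \<delta> \<sigma> (vector_of W \<delta> \<sigma> X)) 0 *s
       S_vec W \<delta> \<sigma> (sweet W \<delta> \<sigma> X) (sweet W \<delta> \<sigma> Y)"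
| "sweet W \<delta> \<sigma> (Replaced X V') =
     (let V0 = sat W \<delta> (vector_of W \<delta> \<sigma> X);
          a = y_exponent (sweet W \<delta> \<sigma> X) V0;
          b = y_exponent V' V0
      in y_mult (Top {a, b}) V0)"

text \<open>A vanishing S-vector or reduct is given the degree of the lcm of the leading terms it was
  formed from.\<close>

definition sugar ::
  "('m, 'n) zmat \<Rightarrow> ('m, 'r) shifts \<Rightarrow> (('n::finite) xpp \<times> 'r) rel \<Rightarrow>
   ('k::field, 'm::{finite,linorder}, 'n, 'r::finite) Fbar_vec occurrence \<Rightarrow> 'm zvec" where
  "sugar W \<delta> \<sigma> X =
     (if sweet W \<delta> \<sigma> X \<noteq> 0 then deg W \<delta> (sweet W \<delta> \<sigma> X)
      else case X of
          SVector Y Z \<Rightarrow> S_lcm_deg W \<delta> \<sigma> (sweet W \<delta> \<sigma> Y) (sweet W \<delta> \<sigma> Z)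
        | Reduct Y Z \<Rightarrow> S_lcm_deg W \<delta> \<sigma> (sweet W \<delta> \<sigma> Y) (sweet W \<delta> \<sigma> Z)
        | _ \<Rightarrow> undefined)"


subsection \<open>Variants of Buchberger's Algorithm\<close>

text \<open>
  A state \<open>(N, P, G, C)\<close> consists of Gens, Pairs, the set \<open>G\<close> of vectors found so far, and the
  current vector of the division in progress, if any. All choices are left open, so
  every variant is covered. Only pairs for which the S-vector is defined are formed.
\<close>

type_synonym 'v state =
  "'v occurrence multiset \<times> ('v occurrence \<times> 'v occurrence) set \<times> 'v occurrence set \<times>
   'v occurrence option"

inductive buchberger_step ::
  "('m, 'n) zmat \<Rightarrow> ('m, 'r) shifts \<Rightarrow> (('n::finite) xpp \<times> 'r) rel \<Rightarrow>
   ('k::field, 'm::{finite,linorder}, 'n, 'r::finite) Fbar_vec state \<Rightarrow>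
   ('k, 'm, 'n, 'r) Fbar_vec state \<Rightarrow> bool"
  for W \<delta> \<sigma> where
  choose_gen:
    "Q \<in># N \<Longrightarrow> buchberger_step W \<delta> \<sigma> (N, P, G, None) (N - {#Q#}, P, G, Some Q)"
| choose_pair:
    "(X, Y) \<in> P \<Longrightarrow>
     buchberger_step W \<delta> \<sigma> (N, P, G, None) (N, P - {(X, Y)}, G, Some (SVector X Y))"
| reduce:
    "vector_of W \<delta> \<sigma> X \<noteq> 0 \<Longrightarrow> Y \<in> G \<Longrightarrow>
     reducible_by W \<delta> \<sigma> (vector_of W \<delta> \<sigma> X) (vector_of W \<delta> \<sigma> Y) \<Longrightarrow>
     buchberger_step W \<delta> \<sigma> (N, P, G, Some X) (N, P, G, Some (Reduct X Y))"
| replace: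
    "vector_of W \<delta> \<sigma> X \<noteq> 0 \<Longrightarrow> homogeneous W \<delta> V' \<Longrightarrow>
     sat W \<delta> V' = sat W \<delta> (vector_of W \<delta> \<sigma> X) \<Longrightarrow>
     buchberger_step W \<delta> \<sigma> (N, P, G, Some X) (N, P, G, Some (Replaced X V'))"
| discard:
    "vector_of W \<delta> \<sigma> X = 0 \<Longrightarrow>
     buchberger_step W \<delta> \<sigma> (N, P, G, Some X) (N, P, G, None)"
| add:
    "vector_of W \<delta> \<sigma> X \<noteq> 0 \<Longrightarrow>
     \<forall>Y\<in>G. \<not> reducible_by W \<delta> \<sigma> (vector_of W \<delta> \<sigma> X) (vector_of W \<delta> \<sigma> Y) \<Longrightarrow>
     P' = {(Y, X) | Y. Y \<in> G \<and> same_component W \<delta> \<sigma> (vector_of W \<delta> \<sigma> Y) (vector_of W \<delta> \<sigma> X)} \<Longrightarrow>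
     buchberger_step W \<delta> \<sigma> (N, P, G, Some X) (N, P \<union> P', insert X G, None)"

text \<open>
  The states passed through in an initial segment of an execution with input vectors \<open>Us\<close>.
  Termination is not built in: vectors used in a possibly infinite execution are
  used in some finite initial segment of it.
\<close>

definition execution ::
  "('m, 'n) zmat \<Rightarrow> ('m, 'r) shifts \<Rightarrow> (('n::finite) xpp \<times> 'r) rel \<Rightarrow>
   ('k::field, 'm::{finite,linorder}, 'n, 'r::finite) Fbar_vec list \<Rightarrow>
   ('k, 'm, 'n, 'r) Fbar_vec state list \<Rightarrow> bool" where
  "execution W \<delta> \<sigma> Us ss \<longleftrightarrow>
     (\<forall>U\<in>set Us. homogeneous W \<delta> U) \<and>
     ss \<noteq> [] \<and> hd ss = (mset (map Input Us), {}, {}, None) \<and>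
     successively (buchberger_step W \<delta> \<sigma>) ss"

definition used_in :: "'v state list \<Rightarrow> 'v occurrence \<Rightarrow> bool" where
  "used_in ss X \<longleftrightarrow> (\<exists>(N, P, G, C)\<in>set ss. X \<in># N \<or> X \<in> G \<or> C = Some X)"

end

theory Submission
  imports Defs
begin

text \<open>
  The proof transports everything to \<open>F\<close> by dehomogenization. In a fixed degree the exponents of
  the \<open>y\<^sub>i\<close> in a term are determined by the remaining part of the term, so a homogeneous vector is
  determined by its degree and its dehomogenization (\<open>homogeneous_eqI\<close>). Consequently a
  non-zero homogeneous \<open>V\<close> is \<open>y\<^sup>a\<close> times its saturation for a unique \<open>a\<close>
  (\<open>homogeneous_eq_y_mult_sat\<close>, \<open>y_exponent_eq\<close>), and the leading coefficient as well as the
  \<open>x\<close>-part and the component of the leading term of \<open>V\<close> can be read off from \<open>deh V\<close> (\<open>LC_cong\<close>,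
  \<open>deh_term_LT_cong\<close>). Moreover, equality of saturations amounts to equality of dehomogenizations.

  For the first claim call \<open>U'\<close> a sweetening of \<open>U\<close> if both are homogeneous, have the same
  dehomogenization and \<open>deg U \<le> deg U'\<close>. This relation holds between each vector and its companion,
  by induction along the execution. It survives the formation of S-vectors: the
  dehomogenization of \<open>S(U, V)\<close> depends on those of \<open>U\<close> and \<open>V\<close> alone (\<open>deh_S_vec_cong\<close>), and passing
  to the companions only raises the exponents of the \<open>y\<^sub>i\<close> in the leading terms, hence in their least
  common multiple, whose degree is the degree of the S-vector (\<open>S_lcm_deg_mono\<close>). Reduction steps are
  S-vectors up to a scalar, and replacements are covered by \<open>sweetening_replaced\<close>.

  For the second claim, the sugar of the reduct is the degree of the least common multiple of the
  leading terms of the companions. These are \<open>y\<^sup>s x\<^sup>t x\<^sup>w e\<^sub>i\<close> and \<open>y\<^sup>z x\<^sup>w e\<^sub>i\<close>, because the companions have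
  the dehomogenizations of \<open>U\<close> and \<open>V\<close>; comparing degrees gives the formula (\<open>S_lcm_deg_eq_Top\<close>).
\<close>


section \<open>Dehomogenization is linear over power products\<close>

definition poly_deh ::
  "(('m::finite, 'n::finite) ypp \<Rightarrow>\<^sub>0 'k::comm_monoid_add) \<Rightarrow> ('n xpp \<Rightarrow>\<^sub>0 'k)" where
  "poly_deh f = (\<Sum>p\<in>Poly_Mapping.keys f.
     Poly_Mapping.single (snd p) (Poly_Mapping.lookup f p))"

lemma deh_component: "deh V $ i = poly_deh (V $ i)"
  by (simp add: deh_def poly_deh_def)

lemma poly_deh_superset:
  assumes "finite A" and "Poly_Mapping.keys f \<subseteq> A"
  shows "poly_deh f = (\<Sum>p\<in>A. Poly_Mapping.single (snd p) (Poly_Mapping.lookup f p))"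
  unfolding poly_deh_def
  by (rule sum.mono_neutral_left) (use assms in \<open>auto simp: in_keys_iff\<close>)

lemma poly_deh_add: "poly_deh (f + g) = poly_deh f + poly_deh g"
proof -
  let ?A = "Poly_Mapping.keys f \<union> Poly_Mapping.keys g"
  have "poly_deh (f + g)
      = (\<Sum>p\<in>?A. Poly_Mapping.single (snd p) (Poly_Mapping.lookup (f + g) p))"
    by (rule poly_deh_superset) (simp_all add: keys_add)
  also have "\<dots> = (\<Sum>p\<in>?A. Poly_Mapping.single (snd p) (Poly_Mapping.lookup f p))
      + (\<Sum>p\<in>?A. Poly_Mapping.single (snd p) (Poly_Mapping.lookup g p))"
    by (simp add: lookup_add single_add sum.distrib)
  also have "\<dots> = poly_deh f + poly_deh g"
    by (simp add: poly_deh_superset [of ?A])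
  finally show ?thesis .
qed

lemma poly_deh_zero [simp]: "poly_deh 0 = 0"
  by (simp add: poly_deh_def)

lemma poly_deh_sum: "poly_deh (sum f A) = (\<Sum>x\<in>A. poly_deh (f x))"
  by (induction A rule: infinite_finite_induct) (simp_all add: poly_deh_add)

lemma poly_deh_single [simp]:
  "poly_deh (Poly_Mapping.single p c) = Poly_Mapping.single (snd p) c"
  by (cases "c = 0") (simp_all add: poly_deh_def)

lemma poly_mapping_eq_sum_single:
  "f = (\<Sum>p\<in>Poly_Mapping.keys f. Poly_Mapping.single p (Poly_Mapping.lookup f p))"
proof (rule poly_mapping_eqI)
  fix q
  have "(\<Sum>p\<in>Poly_Mapping.keys f. Poly_Mapping.lookup f p when p = q)
      = (if q \<in> Poly_Mapping.keys f then Poly_Mapping.lookup f q else 0)"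
    by (simp add: when_def)
  then show "Poly_Mapping.lookup f q = Poly_Mapping.lookup
      (\<Sum>p\<in>Poly_Mapping.keys f. Poly_Mapping.single p (Poly_Mapping.lookup f p)) q"
    by (simp add: lookup_sum lookup_single in_keys_iff)
qed

lemma keys_sum_single_subset:
  "Poly_Mapping.keys (\<Sum>x\<in>A. Poly_Mapping.single (f x) (c x)) \<subseteq> f ` A"
proof -
  have "(\<Union>x\<in>A. Poly_Mapping.keys (Poly_Mapping.single (f x) (c x))) \<subseteq> f ` A"
    by auto
  then show ?thesis
    by (rule subset_trans [OF keys_sum])
qed

lemma poly_deh_single_mult:
  fixes f :: "('m::finite, 'n::finite) ypp \<Rightarrow>\<^sub>0 'k::semiring_0"
  shows "poly_deh (Poly_Mapping.single p c * f) = Poly_Mapping.single (snd p) c * poly_deh f"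
proof -
  let ?K = "Poly_Mapping.keys f" and ?c = "Poly_Mapping.lookup f"
  have "Poly_Mapping.single p c * f
      = Poly_Mapping.single p c * (\<Sum>q\<in>?K. Poly_Mapping.single q (?c q))"
    using poly_mapping_eq_sum_single [of f] by simp
  then have "poly_deh (Poly_Mapping.single p c * f)
      = (\<Sum>q\<in>?K. Poly_Mapping.single (snd p + snd q) (c * ?c q))"
    by (simp add: sum_distrib_left mult_single poly_deh_sum)
  also have "\<dots> = Poly_Mapping.single (snd p) c * poly_deh f"
    by (simp add: poly_deh_def sum_distrib_left mult_single)
  finally show ?thesis .
qed

lemma deh_zero [simp]: "deh 0 = 0"
  by (simp add: vec_eq_iff deh_component)

lemma deh_diff:
  fixes U V :: "('k::ab_group_add, 'm::finite, 'n::finite, 'r::finite) Fbar_vec"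
  shows "deh (U - V) = deh U - deh V"
proof -
  have "poly_deh (f - g) = poly_deh f - poly_deh g" for f g :: "('m, 'n) ypp \<Rightarrow>\<^sub>0 'k"
    using poly_deh_add [of "f - g" g] by (simp add: algebra_simps)
  then show ?thesis
    by (simp add: vec_eq_iff deh_component)
qed

lemma deh_monomial_mult:
  "deh (monomial c p *s V) = Poly_Mapping.single (snd p) c *s deh V"
  by (simp add: vec_eq_iff deh_component monomial_def poly_deh_single_mult)

lemma deh_y_mult [simp]: "deh (y_mult a V) = deh V"
  by (simp add: y_mult_def deh_monomial_mult)


section \<open>Vectors of a given degree\<close>

text \<open>
  The zero vector is homogeneous of every degree here. This makes the notion stable under
  subtraction, and it is what allows one to speak of the degree of an S-vector that vanishes.
\<close>

definition homogeneous_of_degree ::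
  "('m, 'n) zmat \<Rightarrow> ('m, 'r) shifts \<Rightarrow> 'm zvec \<Rightarrow>
   ('k::zero, 'm::finite, 'n::finite, 'r::finite) Fbar_vec \<Rightarrow> bool" where
  "homogeneous_of_degree W \<delta> d V \<longleftrightarrow> (\<forall>a\<in>terms V. term_deg W \<delta> a = d)"

lemma homogeneous_iff: "homogeneous W \<delta> V \<longleftrightarrow> (\<exists>d. homogeneous_of_degree W \<delta> d V)"
  by (simp add: homogeneous_def homogeneous_of_degree_def)

lemma pair_in_terms_iff: "(p, i) \<in> terms V \<longleftrightarrow> p \<in> Poly_Mapping.keys (V $ i)"
  by (simp add: terms_def)

lemma in_terms_iff: "a \<in> terms V \<longleftrightarrow> coeff_at V a \<noteq> 0"
  by (cases a) (simp add: terms_def coeff_at_def in_keys_iff)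

lemma vec_eq_iff_coeff_at: "U = V \<longleftrightarrow> (\<forall>a. coeff_at U a = coeff_at V a)"
  by (auto simp: coeff_at_def vec_eq_iff intro: poly_mapping_eqI)

lemma terms_eq_empty_iff [simp]: "terms V = {} \<longleftrightarrow> V = 0"
  by (auto simp: set_eq_iff in_terms_iff vec_eq_iff_coeff_at) (simp_all add: coeff_at_def)

lemma finite_terms:
  fixes V :: "('t \<Rightarrow>\<^sub>0 'k::zero) ^ 'r::finite"
  shows "finite (terms V)"
proof -
  have "terms V \<subseteq> (\<Union>i. Poly_Mapping.keys (V $ i) \<times> {i})"
    by (auto simp: terms_def)
  then show ?thesis
    by (rule finite_subset) simp
qed

lemma deg_eq:
  assumes "homogeneous_of_degree W \<delta> d V" and "V \<noteq> 0"
  shows "deg W \<delta> V = d"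
proof -
  from \<open>V \<noteq> 0\<close> obtain a where "a \<in> terms V"
    using terms_eq_empty_iff by blast
  then have "term_deg W \<delta> a = d' \<Longrightarrow> d' = d" for d'
    using assms(1) unfolding homogeneous_of_degree_def by simp
  with \<open>a \<in> terms V\<close> assms(1) show ?thesis
    unfolding deg_def homogeneous_of_degree_def by (intro the_equality) blast+
qed

lemma pp_deg_add: "pp_deg W (p + q) = pp_deg W p + pp_deg W q"
  by (simp add: pp_deg_def vec_eq_iff matrix_vector_mult_def distrib_left sum.distrib)

lemma pp_deg_zero [simp]: "pp_deg W 0 = 0"
  using pp_deg_add [of W 0 0] by simp

lemma term_deg_split:
  "term_deg W \<delta> ((s, t), i) = (\<chi> k. int (s $ k)) + F_term_deg W \<delta> (t, i)"
  by (simp add: term_deg_def F_term_deg_def pp_deg_def vec_eq_iff)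

lemma pp_deg_y: "pp_deg W (s, 0) = (\<chi> k. int (s $ k))"
  by (simp add: pp_deg_def vec_eq_iff matrix_vector_mult_def)

lemma homogeneous_of_degree_diff:
  fixes U V :: "('k::ab_group_add, 'm::finite, 'n::finite, 'r::finite) Fbar_vec"
  assumes "homogeneous_of_degree W \<delta> d U" and "homogeneous_of_degree W \<delta> d V"
  shows "homogeneous_of_degree W \<delta> d (U - V)"
proof -
  have "a \<in> terms U \<or> a \<in> terms V" if "a \<in> terms (U - V)" for a
    using that by (auto simp only: in_terms_iff coeff_at_def vector_minus_component lookup_minus
        diff_self)
  then show ?thesis
    using assms unfolding homogeneous_of_degree_def by blast
qed

lemma homogeneous_of_degree_monomial_mult:
  assumes "homogeneous_of_degree W \<delta> d V"
  shows "homogeneous_of_degree W \<delta> (pp_deg W p + d) (monomial c p *s V)"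
  unfolding homogeneous_of_degree_def
proof
  fix a assume "a \<in> terms (monomial c p *s V)"
  then have "fst a \<in> Poly_Mapping.keys (Poly_Mapping.single p c * V $ snd a)"
    by (cases a) (simp add: terms_def monomial_def)
  then obtain q where q: "q \<in> Poly_Mapping.keys (V $ snd a)" "fst a = p + q"
    using keys_mult [of "Poly_Mapping.single p c" "V $ snd a"] by (auto split: if_splits)
  then have "term_deg W \<delta> (q, snd a) = d"
    using assms unfolding homogeneous_of_degree_def pair_in_terms_iff [symmetric] by blast
  with q(2) show "term_deg W \<delta> a = pp_deg W p + d"
    by (simp add: term_deg_def pp_deg_add)
qed

lemma homogeneous_of_degree_y_mult:
  assumes "homogeneous_of_degree W \<delta> d V"
  shows "homogeneous_of_degree W \<delta> ((\<chi> k. int (a $ k)) + d) (y_mult a V)"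
  using homogeneous_of_degree_monomial_mult [OF assms, of "(a, 0)" 1]
  by (simp add: y_mult_def pp_deg_y)


section \<open>A homogeneous vector is determined by its degree and its dehomogenization\<close>

definition deh_term :: "('m::finite, 'n::finite) ypp \<times> 'r \<Rightarrow> 'n xpp \<times> 'r" where
  "deh_term a = (snd (fst a), snd a)"

text \<open>
  In a fixed degree the exponents of the \<open>y\<^sub>i\<close> can be recovered from the rest of the term, because
  \<open>y\<^sub>i\<close> has the \<open>i\<close>-th unit vector as its degree.
\<close>

lemma deh_term_inj:
  assumes "term_deg W \<delta> a = term_deg W \<delta> b" and "deh_term a = deh_term b"
  shows "a = b"
proof -
  obtain s t i s' where "a = ((s, t), i)" "b = ((s', t), i)"
    using assms(2) by (cases a; cases b) (auto simp: deh_term_def)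
  then show ?thesis
    using assms(1) by (simp add: term_deg_split vec_eq_iff)
qed

text \<open>
  Hence no two terms of a homogeneous vector merge under dehomogenization, and its coefficients
  survive unchanged.
\<close>

lemma coeff_at_deh:
  assumes "homogeneous_of_degree W \<delta> d V" and "term_deg W \<delta> a = d"
  shows "coeff_at (deh V) (deh_term a) = coeff_at V a"
proof -
  let ?f = "V $ snd a"
  have *: "p = fst a" if "p \<in> Poly_Mapping.keys ?f" and "snd p = snd (fst a)" for p
  proof -
    have "term_deg W \<delta> (p, snd a) = d"
      using that(1) assms(1) unfolding homogeneous_of_degree_def pair_in_terms_iff [symmetric]
      by blast
    then have "(p, snd a) = a"
      using that(2) assms(2) by (intro deh_term_inj [of W \<delta>]) (auto simp: deh_term_def)
    then show ?thesis by (simp add: prod_eq_iff)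
  qed
  have "coeff_at (deh V) (deh_term a)
      = (\<Sum>p\<in>Poly_Mapping.keys ?f. Poly_Mapping.lookup ?f p when snd p = snd (fst a))"
    by (simp add: coeff_at_def deh_term_def deh_component poly_deh_def lookup_sum lookup_single)
  also have "\<dots> = (\<Sum>p\<in>Poly_Mapping.keys ?f. Poly_Mapping.lookup ?f p when p = fst a)"
    using * by (intro sum.cong) (auto simp: when_def)
  also have "\<dots> = Poly_Mapping.lookup ?f (fst a)"
    by (simp add: when_def in_keys_iff)
  finally show ?thesis by (simp add: coeff_at_def)
qed

lemma terms_deh:
  assumes "homogeneous_of_degree W \<delta> d V"
  shows "terms (deh V) = deh_term ` terms V"
proof
  show "deh_term ` terms V \<subseteq> terms (deh V)"
    using assms coeff_at_deh [OF assms]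
    by (auto simp: in_terms_iff homogeneous_of_degree_def)
  show "terms (deh V) \<subseteq> deh_term ` terms V"
  proof
    fix b assume "b \<in> terms (deh V)"
    then obtain t i where b: "b = (t, i)" and "t \<in> Poly_Mapping.keys (poly_deh (V $ i))"
      by (auto simp: terms_def deh_component)
    then have "t \<in> snd ` Poly_Mapping.keys (V $ i)"
      unfolding poly_deh_def by (intro subsetD [OF keys_sum_single_subset])
    then obtain p where "p \<in> Poly_Mapping.keys (V $ i)" "snd p = t"
      by blast
    then have "(p, i) \<in> terms V" "b = deh_term (p, i)"
      using b by (simp_all add: pair_in_terms_iff deh_term_def)
    then show "b \<in> deh_term ` terms V"
      by blast
  qed
qed

lemma homogeneous_eqI:
  assumes "homogeneous_of_degree W \<delta> d U" and "homogeneous_of_degree W \<delta> d V"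
    and "deh U = deh V"
  shows "U = V"
  unfolding vec_eq_iff_coeff_at
proof
  fix a
  show "coeff_at U a = coeff_at V a"
  proof (cases "term_deg W \<delta> a = d")
    case True
    then show ?thesis
      using coeff_at_deh [OF assms(1)] coeff_at_deh [OF assms(2)] assms(3) by simp
  next
    case False
    then show ?thesis
      using assms(1,2) in_terms_iff [of a U] in_terms_iff [of a V]
      unfolding homogeneous_of_degree_def by auto
  qed
qed

lemma deh_eq_zero_iff:
  assumes "homogeneous W \<delta> V"
  shows "deh V = 0 \<longleftrightarrow> V = 0"
proof -
  from assms obtain d where "homogeneous_of_degree W \<delta> d V"
    by (auto simp: homogeneous_iff)
  then have "terms (deh V) = {} \<longleftrightarrow> terms V = {}"
    by (simp only: terms_deh image_is_empty)
  then show ?thesis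
    by (simp only: terms_eq_empty_iff)
qed


section \<open>Homogenization and saturation\<close>

lemma F_term_deg_le_Top:
  assumes "a \<in> terms v"
  shows "F_term_deg W \<delta> a \<le> Top (F_term_deg W \<delta> ` terms v)"
  using assms by (auto simp: less_eq_vec_def Top_def finite_terms)

lemma hom_component:
  assumes "\<mu> = Top (F_term_deg W \<delta> ` terms v)"
  shows "hom W \<delta> v $ i = (\<Sum>t\<in>Poly_Mapping.keys (v $ i).
    Poly_Mapping.single (\<chi> k. nat ((\<mu> - F_term_deg W \<delta> (t, i)) $ k), t) (Poly_Mapping.lookup (v $ i) t))"
  by (simp add: assms hom_def Let_def)

lemma homogeneous_of_degree_hom:
  "homogeneous_of_degree W \<delta> (Top (F_term_deg W \<delta> ` terms v)) (hom W \<delta> v)"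
  unfolding homogeneous_of_degree_def
proof
  fix a assume a: "a \<in> terms (hom W \<delta> v)"
  define \<mu> where "\<mu> = Top (F_term_deg W \<delta> ` terms v)"
  obtain p i where pi: "a = (p, i)" by (cases a)
  with a have "p \<in> Poly_Mapping.keys (hom W \<delta> v $ i)"
    by (simp add: terms_def)
  then have "p \<in> (\<lambda>t. (\<chi> k. nat ((\<mu> - F_term_deg W \<delta> (t, i)) $ k), t)) ` Poly_Mapping.keys (v $ i)"
    unfolding hom_component [OF \<mu>_def] by (rule subsetD [OF keys_sum_single_subset])
  then obtain t where t: "t \<in> Poly_Mapping.keys (v $ i)"
    and p: "p = (\<chi> k. nat ((\<mu> - F_term_deg W \<delta> (t, i)) $ k), t)"
    by blast
  have "F_term_deg W \<delta> (t, i) \<le> \<mu>"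
    unfolding \<mu>_def by (rule F_term_deg_le_Top) (simp add: terms_def t)
  then have "term_deg W \<delta> a = \<mu>"
    by (simp add: pi p term_deg_split vec_eq_iff less_eq_vec_def)
  then show "term_deg W \<delta> a = Top (F_term_deg W \<delta> ` terms v)"
    by (simp add: \<mu>_def)
qed

lemma deh_hom [simp]:
  fixes v :: "('k::comm_monoid_add, 'n::finite, 'r::finite) F_vec"
  shows "deh (hom W \<delta> v) = v"
proof -
  have "poly_deh (hom W \<delta> v $ i) = v $ i" for i
    unfolding hom_component [OF refl] poly_deh_sum poly_deh_single snd_conv
    by (rule poly_mapping_eq_sum_single [symmetric])
  then show ?thesis
    by (simp add: vec_eq_iff deh_component)
qed

lemma deh_sat [simp]: "deh (sat W \<delta> V) = deh V"
  by (simp add: sat_def)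

lemma sat_eq_iff: "sat W \<delta> U = sat W \<delta> V \<longleftrightarrow> deh U = deh V"
  by (metis deh_sat sat_def)

text \<open>
  The degree of a term of \<open>V\<close> is at least that of its dehomogenization, so \<open>deg V\<close> is at least the
  degree \<open>\<mu>\<close> of the saturation. With \<open>a = deg V - \<mu>\<close> both sides have the same degree and the same
  dehomogenization.
\<close>

lemma homogeneous_eq_y_mult_sat:
  fixes V :: "('k::semiring_1, 'm::finite, 'n::finite, 'r::finite) Fbar_vec"
  assumes "homogeneous_of_degree W \<delta> d V" and "V \<noteq> 0"
  obtains a where "V = y_mult a (sat W \<delta> V)"
proof -
  define \<mu> where "\<mu> = Top (F_term_deg W \<delta> ` terms (deh V))"
  define a where "a = (\<chi> k. nat ((d - \<mu>) $ k))"
  have "b \<le> d" if "b \<in> F_term_deg W \<delta> ` terms (deh V)" for b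
  proof -
    from that obtain s t i where "((s, t), i) \<in> terms V" "b = F_term_deg W \<delta> (t, i)"
      by (auto simp: terms_deh [OF assms(1)] deh_term_def)
    then have "d = (\<chi> k. int (s $ k)) + b"
      using assms(1) term_deg_split by (metis homogeneous_of_degree_def)
    then show ?thesis by (simp add: less_eq_vec_def)
  qed
  moreover have "terms (deh V) \<noteq> {}"
    using assms by (simp add: terms_deh [OF assms(1)])
  ultimately have "\<mu> \<le> d"
    unfolding \<mu>_def Top_def less_eq_vec_def by (auto simp: finite_terms)
  then have d: "(\<chi> k. int (a $ k)) + \<mu> = d"
    by (simp add: a_def vec_eq_iff less_eq_vec_def)
  have "homogeneous_of_degree W \<delta> \<mu> (sat W \<delta> V)"
    unfolding sat_def \<mu>_def by (rule homogeneous_of_degree_hom)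
  then have "homogeneous_of_degree W \<delta> d (y_mult a (sat W \<delta> V))"
    using homogeneous_of_degree_y_mult d by metis
  then have "V = y_mult a (sat W \<delta> V)"
    using assms(1) by (intro homogeneous_eqI) simp_all
  then show ?thesis by (rule that)
qed

text \<open>The exponent is determined by the degrees of the two vectors.\<close>

lemma y_exponent_eq:
  fixes V :: "('k::semiring_1, 'm::finite, 'n::finite, 'r::finite) Fbar_vec"
  assumes "homogeneous_of_degree W \<delta> d V" and "V \<noteq> 0"
  shows "y_exponent (y_mult a V) V = a"
  unfolding y_exponent_def
proof (rule the_equality)
  fix b assume eq: "y_mult a V = y_mult b V"
  have "deh V \<noteq> 0"
    using assms deh_eq_zero_iff homogeneous_iff by blast
  then have "y_mult a V \<noteq> 0"
    by (metis deh_y_mult deh_zero)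
  then have "(\<chi> k. int (a $ k)) + d = (\<chi> k. int (b $ k)) + d"
    using deg_eq homogeneous_of_degree_y_mult [OF assms(1)] eq by metis
  then show "b = a" by (simp add: vec_eq_iff)
qed simp


section \<open>Leading terms and dehomogenization\<close>

lemma finite_has_greatest:
  assumes "linear_order r" and "finite A" and "A \<noteq> {}"
  shows "\<exists>m\<in>A. \<forall>a\<in>A. (a, m) \<in> r"
  using assms(2,3)
proof (induction A rule: finite_ne_induct)
  case (singleton x)
  then show ?case
    using assms(1) by (simp add: order_on_defs refl_on_def)
next
  case (insert x A)
  then obtain m where m: "m \<in> A" "\<forall>a\<in>A. (a, m) \<in> r"
    by blast
  have refl: "(x, x) \<in> r" and tr: "trans r"
    using assms(1) by (auto simp: order_on_defs refl_on_def)
  have "(x, m) \<in> r \<or> (m, x) \<in> r"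
    using assms(1) refl by (cases "x = m") (auto simp: order_on_defs total_on_def)
  then show ?case
  proof
    assume "(x, m) \<in> r"
    with m show ?case by blast
  next
    assume "(m, x) \<in> r"
    then have "(a, x) \<in> r" if "a \<in> A" for a
      using m(2) that transD [OF tr] by blast
    with refl show ?case by blast
  qed
qed

text \<open>
  Within one degree the extended ordering compares terms by their dehomogenizations alone; so
  the leading term of \<open>V\<close> lies over the leading term of \<open>deh V\<close>.
\<close>

lemma LT_greatest:
  assumes "linear_order \<sigma>" and "homogeneous_of_degree W \<delta> d V" and "V \<noteq> 0"
  shows "LT W \<delta> \<sigma> V \<in> terms V"
    and "\<forall>b\<in>terms (deh V). (b, deh_term (LT W \<delta> \<sigma> V)) \<in> \<sigma>"
proof -
  have less_iff: "ext_less W \<delta> \<sigma> b a \<longleftrightarrow> (deh_term b, deh_term a) \<in> \<sigma> \<and> b \<noteq> a"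
    if "a \<in> terms V" "b \<in> terms V" for a b
  proof -
    have "term_deg W \<delta> a = d" "term_deg W \<delta> b = d"
      using that assms(2) unfolding homogeneous_of_degree_def by blast+
    moreover have "\<not> lex_less d d"
      by (simp add: lex_less_def less_fun_irrefl)
    moreover from calculation have "deh_term b \<noteq> deh_term a \<longleftrightarrow> b \<noteq> a"
      using deh_term_inj [of W \<delta> b a] by auto
    ultimately show ?thesis
      unfolding ext_less_def Let_def deh_term_def [symmetric] by simp
  qed
  have "terms (deh V) \<noteq> {}"
    using assms(3) by (simp add: terms_deh [OF assms(2)])
  then obtain m where "m \<in> terms (deh V)" and m: "\<forall>b\<in>terms (deh V). (b, m) \<in> \<sigma>"
    using finite_has_greatest [OF assms(1) finite_terms, of "deh V"] by blast
  then obtain a where a: "a \<in> terms V" "m = deh_term a"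
    unfolding terms_deh [OF assms(2)] by blast
  have *: "\<forall>b\<in>terms V. b \<noteq> a \<longrightarrow> ext_less W \<delta> \<sigma> b a"
  proof (intro ballI impI)
    fix b assume "b \<in> terms V" "b \<noteq> a"
    moreover from this have "(deh_term b, deh_term a) \<in> \<sigma>"
      using m a(2) unfolding terms_deh [OF assms(2)] by blast
    ultimately show "ext_less W \<delta> \<sigma> b a"
      using a(1) less_iff by simp
  qed
  have "LT W \<delta> \<sigma> V = a"
    unfolding LT_def
  proof (rule the_equality)
    show "a \<in> terms V \<and> (\<forall>b\<in>terms V. b \<noteq> a \<longrightarrow> ext_less W \<delta> \<sigma> b a)"
      using a * by blast
  next
    fix c assume c: "c \<in> terms V \<and> (\<forall>b\<in>terms V. b \<noteq> c \<longrightarrow> ext_less W \<delta> \<sigma> b c)"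
    show "c = a"
    proof (rule ccontr)
      assume "c \<noteq> a"
      then have "ext_less W \<delta> \<sigma> c a" "ext_less W \<delta> \<sigma> a c"
        using a(1) c * by simp_all
      then have "(deh_term c, deh_term a) \<in> \<sigma>" "(deh_term a, deh_term c) \<in> \<sigma>"
        using a(1) c less_iff by simp_all
      then have "deh_term c = deh_term a"
        using assms(1) unfolding order_on_defs by (blast dest: antisymD)
      then show False
        using deh_term_inj [of W \<delta> c a] \<open>c \<noteq> a\<close> assms(2) a(1) c
        unfolding homogeneous_of_degree_def by simp
    qed
  qed
  then show "LT W \<delta> \<sigma> V \<in> terms V" "\<forall>b\<in>terms (deh V). (b, deh_term (LT W \<delta> \<sigma> V)) \<in> \<sigma>"
    using a m by simp_all
qed

lemma term_deg_LT:
  fixes V :: "('k::comm_monoid_add, 'm::{finite,linorder}, 'n::finite, 'r::finite) Fbar_vec"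
  assumes "linear_order \<sigma>" and "homogeneous_of_degree W \<delta> d V" and "V \<noteq> 0"
  shows "term_deg W \<delta> (LT W \<delta> \<sigma> V) = d"
  using LT_greatest(1) [OF assms] assms(2) unfolding homogeneous_of_degree_def by blast

lemma LC_nonzero:
  fixes V :: "('k::comm_monoid_add, 'm::{finite,linorder}, 'n::finite, 'r::finite) Fbar_vec"
  assumes "linear_order \<sigma>" and "homogeneous_of_degree W \<delta> d V" and "V \<noteq> 0"
  shows "LC W \<delta> \<sigma> V \<noteq> 0"
  using LT_greatest(1) [OF assms] by (simp add: LC_def in_terms_iff)

lemma deh_term_LT_cong:
  assumes "linear_order \<sigma>" and "deh U = deh V"
    and "homogeneous_of_degree W \<delta> d U" and "U \<noteq> 0"
    and "homogeneous_of_degree W \<delta> e V" and "V \<noteq> 0"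
  shows "deh_term (LT W \<delta> \<sigma> U) = deh_term (LT W \<delta> \<sigma> V)"
proof -
  note U = LT_greatest [OF assms(1,3,4)] and V = LT_greatest [OF assms(1,5,6)]
  have "deh_term (LT W \<delta> \<sigma> U) \<in> terms (deh U)" "deh_term (LT W \<delta> \<sigma> V) \<in> terms (deh V)"
    using U(1) V(1) terms_deh assms(3,5) by blast+
  then have "(deh_term (LT W \<delta> \<sigma> U), deh_term (LT W \<delta> \<sigma> V)) \<in> \<sigma>"
    "(deh_term (LT W \<delta> \<sigma> V), deh_term (LT W \<delta> \<sigma> U)) \<in> \<sigma>"
    using U(2) V(2) assms(2) by simp_all
  then show ?thesis
    using assms(1) unfolding order_on_defs by (blast dest: antisymD)
qed

lemma LC_cong:
  assumes "linear_order \<sigma>" and "deh U = deh V"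
    and "homogeneous_of_degree W \<delta> d U" and "U \<noteq> 0"
    and "homogeneous_of_degree W \<delta> e V" and "V \<noteq> 0"
  shows "LC W \<delta> \<sigma> U = LC W \<delta> \<sigma> V"
  using coeff_at_deh [OF assms(3) term_deg_LT [OF assms(1,3,4)]]
    coeff_at_deh [OF assms(5) term_deg_LT [OF assms(1,5,6)]]
    deh_term_LT_cong [OF assms] assms(2)
  by (simp add: LC_def)


section \<open>S-vectors and reduction\<close>

lemma Top_pair [simp]: "Top {v, w} $ k = max (v $ k) (w $ k)"
  by (simp add: Top_def)

lemma Top_pair_diff_add:
  fixes v w :: "nat ^ 'm"
  shows "(Top {v, w} - v) + v = Top {v, w}" and "(Top {v, w} - w) + w = Top {v, w}"
  by (simp_all add: vec_eq_iff)

lemma pp_lcm_diff_add: "(pp_lcm p q - p) + p = pp_lcm p q" "(pp_lcm p q - q) + q = pp_lcm p q"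
  by (simp_all add: pp_lcm_def prod_eq_iff Top_pair_diff_add)

lemma pp_lcm_add_absorb: "pp_lcm (p + q) q = p + q"
  by (simp add: pp_lcm_def prod_eq_iff vec_eq_iff)

lemma homogeneous_of_degree_S_vec:
  assumes "linear_order \<sigma>" and "same_component W \<delta> \<sigma> U V"
    and U: "homogeneous_of_degree W \<delta> d U" "U \<noteq> 0"
    and V: "homogeneous_of_degree W \<delta> e V" "V \<noteq> 0"
  shows "homogeneous_of_degree W \<delta> (S_lcm_deg W \<delta> \<sigma> U V) (S_vec W \<delta> \<sigma> U V)"
proof -
  define p q i where "p = fst (LT W \<delta> \<sigma> U)" "q = fst (LT W \<delta> \<sigma> V)" "i = snd (LT W \<delta> \<sigma> U)"
  let ?l = "pp_lcm p q"
  have "LT W \<delta> \<sigma> U = (p, i)" "LT W \<delta> \<sigma> V = (q, i)"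
    using assms(2) by (simp_all add: p_q_i_def same_component_def prod_eq_iff)
  then have "term_deg W \<delta> (p, i) = d" "term_deg W \<delta> (q, i) = e"
    using term_deg_LT [OF assms(1) U] term_deg_LT [OF assms(1) V] by simp_all
  then have "pp_deg W (?l - p) + d = term_deg W \<delta> (?l, i)"
    "pp_deg W (?l - q) + e = term_deg W \<delta> (?l, i)"
    using pp_deg_add [of W "?l - p" p] pp_deg_add [of W "?l - q" q]
    by (auto simp: term_deg_def pp_lcm_diff_add)
  then have "homogeneous_of_degree W \<delta> (term_deg W \<delta> (?l, i)) (monomial b (?l - p) *s U)"
    "homogeneous_of_degree W \<delta> (term_deg W \<delta> (?l, i)) (monomial c (?l - q) *s V)" for b c
    using homogeneous_of_degree_monomial_mult [OF U(1), of "?l - p"]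
      homogeneous_of_degree_monomial_mult [OF V(1), of "?l - q"] by simp_all
  then show ?thesis
    unfolding S_vec_def Let_def S_lcm_deg_def p_q_i_def
    by (rule homogeneous_of_degree_diff)
qed

text \<open>
  The least common multiple is formed separately in the \<open>y\<^sub>i\<close> and in the \<open>x\<^sub>j\<close>, so the \<open>x\<close>-parts of the
  cofactors in \<open>S(U, V)\<close> depend only on the \<open>x\<close>-parts of the leading terms.
\<close>

lemma deh_S_vec_cong:
  assumes "linear_order \<sigma>" and "deh U = deh U'" and "deh V = deh V'"
    and U: "homogeneous_of_degree W \<delta> d U" "U \<noteq> 0"
    and U': "homogeneous_of_degree W \<delta> d' U'" "U' \<noteq> 0"
    and V: "homogeneous_of_degree W \<delta> e V" "V \<noteq> 0"
    and V': "homogeneous_of_degree W \<delta> e' V'" "V' \<noteq> 0"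
  shows "deh (S_vec W \<delta> \<sigma> U V) = deh (S_vec W \<delta> \<sigma> U' V')"
proof -
  have "snd (fst (LT W \<delta> \<sigma> U)) = snd (fst (LT W \<delta> \<sigma> U'))"
    "snd (fst (LT W \<delta> \<sigma> V)) = snd (fst (LT W \<delta> \<sigma> V'))"
    using deh_term_LT_cong [OF assms(1,2) U U'] deh_term_LT_cong [OF assms(1,3) V V']
    by (simp_all add: deh_term_def)
  then show ?thesis
    using LC_cong [OF assms(1,2) U U'] LC_cong [OF assms(1,3) V V'] assms(2,3)
    by (simp add: S_vec_def Let_def deh_diff deh_monomial_mult pp_lcm_def)
qed

lemma same_component_cong:
  assumes "linear_order \<sigma>" and "deh U = deh U'" and "deh V = deh V'"
    and U: "homogeneous_of_degree W \<delta> d U" "U \<noteq> 0"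
    and U': "homogeneous_of_degree W \<delta> d' U'" "U' \<noteq> 0"
    and V: "homogeneous_of_degree W \<delta> e V" "V \<noteq> 0"
    and V': "homogeneous_of_degree W \<delta> e' V'" "V' \<noteq> 0"
  shows "same_component W \<delta> \<sigma> U V \<longleftrightarrow> same_component W \<delta> \<sigma> U' V'"
  using deh_term_LT_cong [OF assms(1,2) U U'] deh_term_LT_cong [OF assms(1,3) V V']
  by (simp add: same_component_def deh_term_def)

text \<open>
  Vectors with equal dehomogenizations have leading terms that agree except for the exponents of
  the \<open>y\<^sub>i\<close>, and a larger degree means larger exponents; the least common multiple is monotone
  in these.
\<close>

lemma S_lcm_deg_mono:
  assumes "linear_order \<sigma>" and "deh U = deh U'" and "deh V = deh V'"
    and U: "homogeneous_of_degree W \<delta> d U" "U \<noteq> 0"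
    and U': "homogeneous_of_degree W \<delta> d' U'" "U' \<noteq> 0"
    and V: "homogeneous_of_degree W \<delta> e V" "V \<noteq> 0"
    and V': "homogeneous_of_degree W \<delta> e' V'" "V' \<noteq> 0"
    and "d \<le> d'" and "e \<le> e'"
  shows "S_lcm_deg W \<delta> \<sigma> U V \<le> S_lcm_deg W \<delta> \<sigma> U' V'"
proof -
  obtain s t i where LU: "LT W \<delta> \<sigma> U = ((s, t), i)" by (metis surj_pair)
  obtain z w j where LV: "LT W \<delta> \<sigma> V = ((z, w), j)" by (metis surj_pair)
  obtain s' where LU': "LT W \<delta> \<sigma> U' = ((s', t), i)"
    using deh_term_LT_cong [OF assms(1,2) U U'] LU
    by (cases "LT W \<delta> \<sigma> U'") (auto simp: deh_term_def)
  obtain z' where LV': "LT W \<delta> \<sigma> V' = ((z', w), j)"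
    using deh_term_LT_cong [OF assms(1,3) V V'] LV
    by (cases "LT W \<delta> \<sigma> V'") (auto simp: deh_term_def)
  have "s \<le> s'"
    using term_deg_LT [OF assms(1) U] term_deg_LT [OF assms(1) U'] \<open>d \<le> d'\<close> LU LU'
    by (auto simp: term_deg_split less_eq_vec_def)
  moreover have "z \<le> z'"
    using term_deg_LT [OF assms(1) V] term_deg_LT [OF assms(1) V'] \<open>e \<le> e'\<close> LV LV'
    by (auto simp: term_deg_split less_eq_vec_def)
  ultimately show ?thesis
    unfolding less_eq_vec_def
    by (simp add: S_lcm_deg_def LU LV LU' LV' pp_lcm_def term_deg_split max.coboundedI1
        max.coboundedI2)
qed

text \<open>
  If \<open>LT V\<close> divides \<open>LT U\<close>, then \<open>LT U\<close> is the least common multiple. So the result of a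
  reduction step is a scalar multiple of an S-vector.
\<close>

lemma reduct_eq_S_vec:
  fixes U V :: "('k::field, 'm::{finite,linorder}, 'n::finite, 'r::finite) Fbar_vec"
  assumes "linear_order \<sigma>" and "homogeneous_of_degree W \<delta> d U" "U \<noteq> 0"
    and "reducible_by W \<delta> \<sigma> U V"
  shows "reduct W \<delta> \<sigma> U V = monomial (LC W \<delta> \<sigma> U) 0 *s S_vec W \<delta> \<sigma> U V"
proof -
  have "monomial (LC W \<delta> \<sigma> U) 0 * monomial (1 / LC W \<delta> \<sigma> U) (0 :: ('m, 'n) ypp) = 1"
    using LC_nonzero [OF assms(1-3)] by (simp add: monomial_def mult_single flip: single_one)
  moreover from assms(4) have "pp_lcm (fst (LT W \<delta> \<sigma> U)) (fst (LT W \<delta> \<sigma> V)) = fst (LT W \<delta> \<sigma> U)"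
    by (auto simp: reducible_by_def pp_lcm_add_absorb)
  moreover have "monomial (LC W \<delta> \<sigma> U) 0 * monomial (1 / LC W \<delta> \<sigma> V) p
      = monomial (LC W \<delta> \<sigma> U / LC W \<delta> \<sigma> V) p" for p :: "('m, 'n) ypp"
    by (simp add: monomial_def mult_single)
  ultimately show ?thesis
    unfolding reduct_def S_vec_def Let_def
    by (simp only: vector_ssub_ldistrib vector_smult_assoc vector_smult_lid diff_self
        cancel_comm_monoid_add_class.diff_cancel)
qed


section \<open>The companion of every vector differs from it only in the new indeterminates\<close>

text \<open>
  This relation between a vector and its companion is what every step of the algorithm preserves.
  For non-zero homogeneous vectors it says that \<open>U' = y\<^sup>a U\<close> for some \<open>a\<close>; stated through degrees and
  dehomogenizations, it passes to S-vectors without a computation of that exponent.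
\<close>

definition sweetening ::
  "('m, 'n) zmat \<Rightarrow> ('m, 'r) shifts \<Rightarrow>
   ('k::comm_monoid_add, 'm::finite, 'n::finite, 'r::finite) Fbar_vec \<Rightarrow>
   ('k, 'm, 'n, 'r) Fbar_vec \<Rightarrow> bool" where
  "sweetening W \<delta> U U' \<longleftrightarrow> deh U' = deh U \<and>
     (\<exists>d d'. homogeneous_of_degree W \<delta> d U \<and> homogeneous_of_degree W \<delta> d' U' \<and> d \<le> d')"

lemma sweetening_refl: "homogeneous W \<delta> U \<Longrightarrow> sweetening W \<delta> U U"
  by (auto simp: sweetening_def homogeneous_iff)

lemma sweetening_eq_zero_iff:
  assumes "sweetening W \<delta> U U'"
  shows "U' = 0 \<longleftrightarrow> U = 0"
proof -
  have "homogeneous W \<delta> U" "homogeneous W \<delta> U'" "deh U' = deh U"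
    using assms by (auto simp: sweetening_def homogeneous_iff)
  then show ?thesis
    using deh_eq_zero_iff [of W \<delta> U] deh_eq_zero_iff [of W \<delta> U'] by simp
qed

lemma sweetening_monomial_mult:
  assumes "sweetening W \<delta> U U'"
  shows "sweetening W \<delta> (monomial c p *s U) (monomial c p *s U')"
proof -
  from assms obtain d d' where "deh U' = deh U" "d \<le> d'"
    "homogeneous_of_degree W \<delta> d U" "homogeneous_of_degree W \<delta> d' U'"
    by (auto simp: sweetening_def)
  moreover from this have "pp_deg W p + d \<le> pp_deg W p + d'"
    by (simp add: less_eq_vec_def)
  ultimately show ?thesis
    unfolding sweetening_def deh_monomial_mult
    by (auto intro!: exI homogeneous_of_degree_monomial_mult)
qed

lemma sweetening_S_vec:
  assumes "linear_order \<sigma>" and "same_component W \<delta> \<sigma> U V"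
    and sU: "sweetening W \<delta> U U'" and "U \<noteq> 0" and sV: "sweetening W \<delta> V V'" and "V \<noteq> 0"
  shows "sweetening W \<delta> (S_vec W \<delta> \<sigma> U V) (S_vec W \<delta> \<sigma> U' V')"
proof -
  from sU obtain d d' where U: "deh U = deh U'" "d \<le> d'"
    "homogeneous_of_degree W \<delta> d U" "homogeneous_of_degree W \<delta> d' U'"
    by (auto simp: sweetening_def)
  from sV obtain e e' where V: "deh V = deh V'" "e \<le> e'"
    "homogeneous_of_degree W \<delta> e V" "homogeneous_of_degree W \<delta> e' V'"
    by (auto simp: sweetening_def)
  have nz: "U' \<noteq> 0" "V' \<noteq> 0"
    using assms sweetening_eq_zero_iff by blast+
  have "same_component W \<delta> \<sigma> U' V'"
    using same_component_cong [OF assms(1) U(1) V(1) U(3) \<open>U \<noteq> 0\<close> U(4) nz(1) V(3) \<open>V \<noteq> 0\<close> V(4) nz(2)]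
      assms(2) by simp
  then show ?thesis
    using deh_S_vec_cong [OF assms(1) U(1) V(1) U(3) \<open>U \<noteq> 0\<close> U(4) nz(1) V(3) \<open>V \<noteq> 0\<close> V(4) nz(2)]
      S_lcm_deg_mono [OF assms(1) U(1) V(1) U(3) \<open>U \<noteq> 0\<close> U(4) nz(1) V(3) \<open>V \<noteq> 0\<close> V(4) nz(2) U(2) V(2)]
      homogeneous_of_degree_S_vec [OF assms(1,2) U(3) \<open>U \<noteq> 0\<close> V(3) \<open>V \<noteq> 0\<close>]
      homogeneous_of_degree_S_vec [OF assms(1) _ U(4) nz(1) V(4) nz(2)]
    unfolding sweetening_def by auto
qed

text \<open>
  Both \<open>V'\<close> and the old companion are multiples \<open>y\<^sup>b V\<^sub>0\<close> and \<open>y\<^sup>a V\<^sub>0\<close> of the common saturation \<open>V\<^sub>0\<close>.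
  The exponent \<open>Top {a, b}\<close> of the new companion is at least \<open>b\<close>, so its degree is at least that
  of \<open>V'\<close>.
\<close>

lemma sweetening_replaced:
  fixes V V' :: "('k::field, 'm::finite, 'n::finite, 'r::finite) Fbar_vec"
  assumes "sweetening W \<delta> V Vsw" and "V \<noteq> 0"
    and "homogeneous W \<delta> V'" and "sat W \<delta> V' = sat W \<delta> V"
  shows "sweetening W \<delta> V'
    (y_mult (Top {y_exponent Vsw (sat W \<delta> V), y_exponent V' (sat W \<delta> V)}) (sat W \<delta> V))"
proof -
  define V0 where "V0 = sat W \<delta> V"
  define a b where "a = y_exponent Vsw V0" "b = y_exponent V' V0"
  obtain \<mu> where V0: "homogeneous_of_degree W \<delta> \<mu> V0"
    unfolding V0_def sat_def using homogeneous_of_degree_hom by blast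
  obtain d' where "homogeneous_of_degree W \<delta> d' V'"
    using assms(3) by (auto simp: homogeneous_iff)
  moreover have deh_V': "deh V' = deh V"
    using assms(4) by (simp add: sat_eq_iff)
  moreover have "deh V \<noteq> 0"
    using assms(1,2) deh_eq_zero_iff homogeneous_iff unfolding sweetening_def by blast
  moreover from calculation have "V' \<noteq> 0"
    by auto
  ultimately obtain b' where "V' = y_mult b' V0"
    using homogeneous_eq_y_mult_sat [of W \<delta> d' V'] assms(4) V0_def by metis
  moreover have "V0 \<noteq> 0"
    using \<open>deh V \<noteq> 0\<close> V0_def by (metis deh_sat deh_zero)
  ultimately have V': "V' = y_mult b V0"
    using y_exponent_eq [OF V0] by (simp add: a_b_def)
  have "(\<chi> k. int (b $ k)) + \<mu> \<le> (\<chi> k. int (Top {a, b} $ k)) + \<mu>"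
    by (simp add: less_eq_vec_def)
  then have "sweetening W \<delta> V' (y_mult (Top {a, b}) V0)"
    unfolding sweetening_def V' deh_y_mult using homogeneous_of_degree_y_mult [OF V0] by blast
  then show ?thesis
    by (simp add: a_b_def V0_def)
qed

definition sweetened ::
  "('m, 'n) zmat \<Rightarrow> ('m, 'r) shifts \<Rightarrow> (('n::finite) xpp \<times> 'r) rel \<Rightarrow>
   ('k::field, 'm::{finite,linorder}, 'n, 'r::finite) Fbar_vec occurrence \<Rightarrow> bool" where
  "sweetened W \<delta> \<sigma> X \<longleftrightarrow> sweetening W \<delta> (vector_of W \<delta> \<sigma> X) (sweet W \<delta> \<sigma> X)"

lemma sweetened_Reduct:
  assumes "linear_order \<sigma>" and "sweetened W \<delta> \<sigma> X" and "sweetened W \<delta> \<sigma> Y"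
    and "vector_of W \<delta> \<sigma> X \<noteq> 0" and "vector_of W \<delta> \<sigma> Y \<noteq> 0"
    and "reducible_by W \<delta> \<sigma> (vector_of W \<delta> \<sigma> X) (vector_of W \<delta> \<sigma> Y)"
  shows "sweetened W \<delta> \<sigma> (Reduct X Y)"
proof -
  obtain d where "homogeneous_of_degree W \<delta> d (vector_of W \<delta> \<sigma> X)"
    using assms(2) by (auto simp: sweetened_def sweetening_def)
  then have "vector_of W \<delta> \<sigma> (Reduct X Y) = monomial (LC W \<delta> \<sigma> (vector_of W \<delta> \<sigma> X)) 0 *s
      S_vec W \<delta> \<sigma> (vector_of W \<delta> \<sigma> X) (vector_of W \<delta> \<sigma> Y)"
    using reduct_eq_S_vec assms(1,4,6) by simp
  then show ?thesis
    using assms unfolding sweetened_def reducible_by_def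
    by (simp add: sweetening_monomial_mult sweetening_S_vec)
qed

lemma sweetened_SVector:
  assumes "linear_order \<sigma>" and "sweetened W \<delta> \<sigma> X" and "sweetened W \<delta> \<sigma> Y"
    and "vector_of W \<delta> \<sigma> X \<noteq> 0" and "vector_of W \<delta> \<sigma> Y \<noteq> 0"
    and "same_component W \<delta> \<sigma> (vector_of W \<delta> \<sigma> X) (vector_of W \<delta> \<sigma> Y)"
  shows "sweetened W \<delta> \<sigma> (SVector X Y)"
  using assms by (simp add: sweetened_def sweetening_S_vec)

lemma sweetened_Replaced:
  assumes "sweetened W \<delta> \<sigma> X" and "vector_of W \<delta> \<sigma> X \<noteq> 0"
    and "homogeneous W \<delta> V'" and "sat W \<delta> V' = sat W \<delta> (vector_of W \<delta> \<sigma> X)"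
  shows "sweetened W \<delta> \<sigma> (Replaced X V')"
  using sweetening_replaced [of W \<delta> "vector_of W \<delta> \<sigma> X" "sweet W \<delta> \<sigma> X" V'] assms
  by (simp add: sweetened_def Let_def)


section \<open>Executions\<close>

text \<open>
  Besides the companions, the invariant records that pairs are formed from non-zero vectors whose
  leading terms lie in the same component, since only for those the S-vector is meaningful.
\<close>

fun sweetened_state ::
  "('m, 'n) zmat \<Rightarrow> ('m, 'r) shifts \<Rightarrow> (('n::finite) xpp \<times> 'r) rel \<Rightarrow>
   ('k::field, 'm::{finite,linorder}, 'n, 'r::finite) Fbar_vec state \<Rightarrow> bool" where
  "sweetened_state W \<delta> \<sigma> (N, P, G, C) \<longleftrightarrow>
     (\<forall>X\<in>#N. sweetened W \<delta> \<sigma> X) \<and>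
     (\<forall>X\<in>G. sweetened W \<delta> \<sigma> X \<and> vector_of W \<delta> \<sigma> X \<noteq> 0) \<and>
     (\<forall>X Y. (X, Y) \<in> P \<longrightarrow> X \<in> G \<and> Y \<in> G \<and>
        same_component W \<delta> \<sigma> (vector_of W \<delta> \<sigma> X) (vector_of W \<delta> \<sigma> Y)) \<and>
     (\<forall>X. C = Some X \<longrightarrow> sweetened W \<delta> \<sigma> X)"

lemma sweetened_state_step:
  assumes "linear_order \<sigma>" and "buchberger_step W \<delta> \<sigma> S S'" and "sweetened_state W \<delta> \<sigma> S"
  shows "sweetened_state W \<delta> \<sigma> S'"
  using assms(2,3)
proof cases
  case (choose_pair X Y P N G)
  then show ?thesis
    using assms(1,3) by (auto intro: sweetened_SVector)
next
  case (reduce X Y G N P)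
  then show ?thesis
    using assms(1,3) by (auto intro: sweetened_Reduct)
next
  case (replace X V' N P G)
  then show ?thesis
    using assms(3) by (auto intro: sweetened_Replaced)
qed (use assms(3) in \<open>auto dest: in_diffD\<close>)

lemma sweetened_used_in:
  assumes "linear_order \<sigma>" and "execution W \<delta> \<sigma> Us ss" and "used_in ss X"
  shows "sweetened W \<delta> \<sigma> X"
proof -
  have "\<forall>S\<in>set ss. sweetened_state W \<delta> \<sigma> S"
    if "successively (buchberger_step W \<delta> \<sigma>) ss" and "sweetened_state W \<delta> \<sigma> (hd ss)"
    using that
  proof (induction ss)
    case (Cons S ss)
    have S: "sweetened_state W \<delta> \<sigma> S"
      using Cons.prems(2) by simp
    show ?case
    proof (cases "ss = []")
      case True
      with S show ?thesis by simp
    next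
      case False
      then have "buchberger_step W \<delta> \<sigma> S (hd ss)" and ss: "successively (buchberger_step W \<delta> \<sigma>) ss"
        using Cons.prems(1) by (simp_all add: successively_Cons)
      from sweetened_state_step [OF assms(1) this(1) S] have "sweetened_state W \<delta> \<sigma> (hd ss)" .
      with Cons.IH ss S show ?thesis by simp
    qed
  qed simp
  moreover have "sweetened_state W \<delta> \<sigma> (hd ss)"
    using assms(2) by (auto simp: execution_def sweetened_def sweetening_refl)
  ultimately have "\<forall>S\<in>set ss. sweetened_state W \<delta> \<sigma> S"
    using assms(2) by (simp add: execution_def)
  moreover obtain N P G C where "(N, P, G, C) \<in> set ss" and X: "X \<in># N \<or> X \<in> G \<or> C = Some X"
    using assms(3) unfolding used_in_def by blast
  ultimately have "sweetened_state W \<delta> \<sigma> (N, P, G, C)" by blast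
  with X show ?thesis by auto
qed


section \<open>Sugar\<close>

lemma sugar_eq_deg: "sweet W \<delta> \<sigma> X \<noteq> 0 \<Longrightarrow> sugar W \<delta> \<sigma> X = deg W \<delta> (sweet W \<delta> \<sigma> X)"
  by (simp add: sugar_def)

lemma sweetened_imp_sat_and_deg:
  assumes "sweetened W \<delta> \<sigma> X" and "vector_of W \<delta> \<sigma> X \<noteq> 0"
  shows "sat W \<delta> (sweet W \<delta> \<sigma> X) = sat W \<delta> (vector_of W \<delta> \<sigma> X)"
    and "deg W \<delta> (vector_of W \<delta> \<sigma> X) \<le> sugar W \<delta> \<sigma> X"
proof -
  show "sat W \<delta> (sweet W \<delta> \<sigma> X) = sat W \<delta> (vector_of W \<delta> \<sigma> X)"
    using assms(1) by (simp add: sweetened_def sweetening_def sat_eq_iff)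
  have "sweet W \<delta> \<sigma> X \<noteq> 0"
    using assms sweetening_eq_zero_iff unfolding sweetened_def by blast
  then show "deg W \<delta> (vector_of W \<delta> \<sigma> X) \<le> sugar W \<delta> \<sigma> X"
    using assms by (auto simp: sugar_eq_deg sweetened_def sweetening_def deg_eq)
qed

text \<open>
  If the leading terms are \<open>y\<^sup>s x\<^sup>t x\<^sup>w e\<^sub>i\<close> and \<open>y\<^sup>z x\<^sup>w e\<^sub>i\<close>, then their least common multiple is \<open>y\<close> to
  the power \<open>Top {s, z}\<close> times \<open>x\<^sup>t x\<^sup>w e\<^sub>i\<close>. The terms \<open>y\<^sup>s x\<^sup>t x\<^sup>w e\<^sub>i\<close> and \<open>y\<^sup>z x\<^sup>t x\<^sup>w e\<^sub>i\<close> have the degrees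
  of \<open>U\<close> and of \<open>x\<^sup>t V\<close>, and since they agree outside the \<open>y\<^sub>i\<close>, the componentwise maximum of the
  exponents becomes that of the degrees.
\<close>

lemma S_lcm_deg_eq_Top:
  assumes "linear_order \<sigma>"
    and U: "homogeneous_of_degree W \<delta> d U" "U \<noteq> 0"
    and V: "homogeneous_of_degree W \<delta> e V" "V \<noteq> 0"
    and "same_component W \<delta> \<sigma> U V"
    and "snd (fst (LT W \<delta> \<sigma> U)) = t + snd (fst (LT W \<delta> \<sigma> V))"
  shows "S_lcm_deg W \<delta> \<sigma> U V = Top {d, pp_deg W (0, t) + e}"
proof -
  obtain s w z i where L: "LT W \<delta> \<sigma> U = ((s, t + w), i)" "LT W \<delta> \<sigma> V = ((z, w), i)"
    using assms(6,7) unfolding same_component_def by (metis prod.collapse)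
  have "d = (\<chi> k. int (s $ k)) + F_term_deg W \<delta> (t + w, i)"
    "e = (\<chi> k. int (z $ k)) + F_term_deg W \<delta> (w, i)"
    using term_deg_LT [OF assms(1) U] term_deg_LT [OF assms(1) V] by (simp_all add: L term_deg_split)
  moreover have "F_term_deg W \<delta> (t + w, i) = pp_deg W (0, t) + F_term_deg W \<delta> (w, i)"
    using pp_deg_add [of W "(0, t)" "(0, w)"] by (simp add: F_term_deg_def term_deg_def)
  moreover have absorb: "Top {t + w, w} = t + w"
    by (simp add: vec_eq_iff)
  ultimately show ?thesis
    by (simp add: S_lcm_deg_def L pp_lcm_def absorb term_deg_split)
       (auto simp: vec_eq_iff of_nat_max max_def)
qed

text \<open>
  Whether or not the companion of the reduct vanishes, its sugar is the degree of the least common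
  multiple: by homogeneity in the one case and by convention in the other.
\<close>

lemma sugar_Reduct:
  assumes "linear_order \<sigma>" and "same_component W \<delta> \<sigma> (sweet W \<delta> \<sigma> X) (sweet W \<delta> \<sigma> Y)"
    and "homogeneous_of_degree W \<delta> d (sweet W \<delta> \<sigma> X)" and "sweet W \<delta> \<sigma> X \<noteq> 0"
    and "homogeneous_of_degree W \<delta> e (sweet W \<delta> \<sigma> Y)" and "sweet W \<delta> \<sigma> Y \<noteq> 0"
  shows "sugar W \<delta> \<sigma> (Reduct X Y) = S_lcm_deg W \<delta> \<sigma> (sweet W \<delta> \<sigma> X) (sweet W \<delta> \<sigma> Y)"
proof (cases "sweet W \<delta> \<sigma> (Reduct X Y) = 0")
  case True
  then show ?thesis by (simp add: sugar_def)
next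
  case False
  have "homogeneous_of_degree W \<delta> (S_lcm_deg W \<delta> \<sigma> (sweet W \<delta> \<sigma> X) (sweet W \<delta> \<sigma> Y))
      (sweet W \<delta> \<sigma> (Reduct X Y))"
    using homogeneous_of_degree_monomial_mult [OF homogeneous_of_degree_S_vec [OF assms], of 0]
    by (simp add: pp_deg_zero)
  then show ?thesis
    using False by (metis sugar_eq_deg deg_eq)
qed

theorem proposition25:
  fixes W :: "('m::{finite,linorder}, 'n::finite) zmat"
    and \<delta> :: "('m, 'r::finite) shifts"
    and \<sigma> :: "('n xpp \<times> 'r) rel"
    and Us :: "('k::field, 'm, 'n, 'r) Fbar_vec list"
    and ss :: "('k, 'm, 'n, 'r) Fbar_vec state list"
    and U V :: "('k, 'm, 'n, 'r) Fbar_vec occurrence"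
  assumes "rank (\<chi> k j. real_of_int (W $ k $ j)) = CARD('m)"
    and "module_ordering \<sigma>"
    and "execution W \<delta> \<sigma> Us ss"
    and "used_in ss U" and "homogeneous W \<delta> (vector_of W \<delta> \<sigma> U)" and "vector_of W \<delta> \<sigma> U \<noteq> 0"
    and "used_in ss V" and "homogeneous W \<delta> (vector_of W \<delta> \<sigma> V)" and "vector_of W \<delta> \<sigma> V \<noteq> 0"
  shows
    "(sat W \<delta> (sweet W \<delta> \<sigma> U) = sat W \<delta> (vector_of W \<delta> \<sigma> U) \<and>
      deg W \<delta> (vector_of W \<delta> \<sigma> U) \<le> sugar W \<delta> \<sigma> U) \<and>
     (\<forall>a t c A.
        LT W \<delta> \<sigma> (vector_of W \<delta> \<sigma> U) =
          ((a, t) + fst (LT W \<delta> \<sigma> (vector_of W \<delta> \<sigma> V)), snd (LT W \<delta> \<sigma> (vector_of W \<delta> \<sigma> V))) \<longrightarrow>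
        LC W \<delta> \<sigma> (vector_of W \<delta> \<sigma> U) = c * LC W \<delta> \<sigma> (vector_of W \<delta> \<sigma> V) \<longrightarrow>
        A = vector_of W \<delta> \<sigma> U - monomial c (a, t) *s vector_of W \<delta> \<sigma> V \<longrightarrow>
        vector_of W \<delta> \<sigma> (Reduct U V) = A \<and>
        sugar W \<delta> \<sigma> (Reduct U V) = Top {sugar W \<delta> \<sigma> U, pp_deg W (0, t) + sugar W \<delta> \<sigma> V})"
proof (intro conjI allI impI)
  have \<sigma>: "linear_order \<sigma>"
    using assms(2) by (simp add: module_ordering_def)
  let ?u = "vector_of W \<delta> \<sigma> U" and ?v = "vector_of W \<delta> \<sigma> V"
  let ?u' = "sweet W \<delta> \<sigma> U" and ?v' = "sweet W \<delta> \<sigma> V"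
  have swU: "sweetened W \<delta> \<sigma> U" and swV: "sweetened W \<delta> \<sigma> V"
    using sweetened_used_in [OF \<sigma>] assms by blast+
  show "sat W \<delta> ?u' = sat W \<delta> ?u" and "deg W \<delta> ?u \<le> sugar W \<delta> \<sigma> U"
    using sweetened_imp_sat_and_deg [OF swU] assms(6) by simp_all
  obtain d d' where u: "homogeneous_of_degree W \<delta> d ?u" "?u \<noteq> 0"
      and u': "homogeneous_of_degree W \<delta> d' ?u'" "?u' \<noteq> 0" and deh_u: "deh ?u' = deh ?u"
    using swU assms(6) sweetening_eq_zero_iff [of W \<delta> ?u ?u']
    by (auto simp: sweetened_def sweetening_def)
  obtain e e' where v: "homogeneous_of_degree W \<delta> e ?v" "?v \<noteq> 0"
      and v': "homogeneous_of_degree W \<delta> e' ?v'" "?v' \<noteq> 0" and deh_v: "deh ?v' = deh ?v"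
    using swV assms(9) sweetening_eq_zero_iff [of W \<delta> ?v ?v']
    by (auto simp: sweetened_def sweetening_def)
  fix a t c A
  assume LT: "LT W \<delta> \<sigma> ?u = ((a, t) + fst (LT W \<delta> \<sigma> ?v), snd (LT W \<delta> \<sigma> ?v))"
    and LC: "LC W \<delta> \<sigma> ?u = c * LC W \<delta> \<sigma> ?v"
    and A: "A = ?u - monomial c (a, t) *s ?v"
  have "LC W \<delta> \<sigma> ?u / LC W \<delta> \<sigma> ?v = c"
    using LC LC_nonzero [OF \<sigma> v] by simp
  then show "vector_of W \<delta> \<sigma> (Reduct U V) = A"
    by (simp add: A reduct_def LT)
  have same: "same_component W \<delta> \<sigma> ?u' ?v'"
    using same_component_cong [OF \<sigma> deh_u deh_v u' u v' v] LT by (simp add: same_component_def)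
  have "snd (fst (LT W \<delta> \<sigma> ?u')) = t + snd (fst (LT W \<delta> \<sigma> ?v'))"
    using deh_term_LT_cong [OF \<sigma> deh_u u' u] deh_term_LT_cong [OF \<sigma> deh_v v' v] LT
    by (simp add: deh_term_def)
  then have "sugar W \<delta> \<sigma> (Reduct U V) = Top {d', pp_deg W (0, t) + e'}"
    using sugar_Reduct [OF \<sigma> same u' v'] S_lcm_deg_eq_Top [OF \<sigma> u' v' same] by simp
  then show "sugar W \<delta> \<sigma> (Reduct U V) = Top {sugar W \<delta> \<sigma> U, pp_deg W (0, t) + sugar W \<delta> \<sigma> V}"
    using deg_eq [OF u'] deg_eq [OF v'] u'(2) v'(2) by (simp add: sugar_eq_deg)
qed

end
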